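(* The predicate $MaxFilt(X)$, which states that $X$ is a maximal filter in a (countable) poset, is $\Pi^1_1$ in general.
   Context: For a poset $P$, a pre-filter is a nonempty $R\subseteq P$ such that for all $x,y\in R$ there is $z\in R$ with $z\le x$ and $z\le y$. A filter is an upward closed pre-filter. A maximal filter is a filter not strictly contained in any filter. Countable posets are coded as subsets of $\mathbb N$, and $\Pi^1_1$ refers to formulas of second order arithmetic. *)

theory Defs
  imports Main "HOL-Library.Nat_Bijection"
begin

section \<open>Filters in posets\<close>

text \<open>A poset is a carrier \<open>P\<close> with an order \<open>r\<close>, where \<open>partial_order_on P r\<close>
  and \<open>(x, y) \<in> r\<close> means \<open>x \<le> y\<close>.\<close>

definition prefilter_on :: "'a set \<Rightarrow> 'a rel \<Rightarrow> 'a set \<Rightarrow> bool" where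
  "prefilter_on P r R \<longleftrightarrow>
     R \<subseteq> P \<and> R \<noteq> {} \<and> (\<forall>x\<in>R. \<forall>y\<in>R. \<exists>z\<in>R. (z, x) \<in> r \<and> (z, y) \<in> r)"

definition filter_on :: "'a set \<Rightarrow> 'a rel \<Rightarrow> 'a set \<Rightarrow> bool" where
  "filter_on P r F \<longleftrightarrow> prefilter_on P r F \<and> (\<forall>x\<in>F. \<forall>y\<in>P. (x, y) \<in> r \<longrightarrow> y \<in> F)"

definition MaxFilt :: "'a set \<Rightarrow> 'a rel \<Rightarrow> 'a set \<Rightarrow> bool" where
  "MaxFilt P r X \<longleftrightarrow> filter_on P r X \<and> \<not> (\<exists>Y. filter_on P r Y \<and> X \<subset> Y)"

section \<open>Formulas of second order arithmetic\<close>

text \<open>Number variables and set variables are two separate families, each named by natural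
  numbers.\<close>

datatype tm = Var nat | Zero | One | Add tm tm | Mult tm tm

datatype fm =
    Eq tm tm
  | Less tm tm
  | Mem tm nat
  | Neg fm
  | Conj fm fm
  | Disj fm fm
  | Imp fm fm
  | Iff fm fm
  | AllN nat fm
  | ExN nat fm
  | AllS nat fm
  | ExS nat fm

primrec tm_val :: "(nat \<Rightarrow> nat) \<Rightarrow> tm \<Rightarrow> nat" where
  "tm_val e (Var n) = e n"
| "tm_val e Zero = 0"
| "tm_val e One = 1"
| "tm_val e (Add t u) = tm_val e t + tm_val e u"
| "tm_val e (Mult t u) = tm_val e t * tm_val e u"

text \<open>Truth in the standard model: \<open>e\<close> assigns numbers to the number variables, \<open>s\<close> assigns sets
  to the set variables, and set quantifiers range over all subsets of the natural numbers.\<close>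

primrec sat :: "(nat \<Rightarrow> nat) \<Rightarrow> (nat \<Rightarrow> nat set) \<Rightarrow> fm \<Rightarrow> bool" where
  "sat e s (Eq t u) \<longleftrightarrow> tm_val e t = tm_val e u"
| "sat e s (Less t u) \<longleftrightarrow> tm_val e t < tm_val e u"
| "sat e s (Mem t A) \<longleftrightarrow> tm_val e t \<in> s A"
| "sat e s (Neg f) \<longleftrightarrow> \<not> sat e s f"
| "sat e s (Conj f g) \<longleftrightarrow> sat e s f \<and> sat e s g"
| "sat e s (Disj f g) \<longleftrightarrow> sat e s f \<or> sat e s g"
| "sat e s (Imp f g) \<longleftrightarrow> (sat e s f \<longrightarrow> sat e s g)"
| "sat e s (Iff f g) \<longleftrightarrow> (sat e s f \<longleftrightarrow> sat e s g)"
| "sat e s (AllN n f) \<longleftrightarrow> (\<forall>k. sat (e(n := k)) s f)"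
| "sat e s (ExN n f) \<longleftrightarrow> (\<exists>k. sat (e(n := k)) s f)"
| "sat e s (AllS A f) \<longleftrightarrow> (\<forall>B. sat e (s(A := B)) f)"
| "sat e s (ExS A f) \<longleftrightarrow> (\<exists>B. sat e (s(A := B)) f)"

primrec tm_vars :: "tm \<Rightarrow> nat set" where
  "tm_vars (Var n) = {n}"
| "tm_vars Zero = {}"
| "tm_vars One = {}"
| "tm_vars (Add t u) = tm_vars t \<union> tm_vars u"
| "tm_vars (Mult t u) = tm_vars t \<union> tm_vars u"

primrec free_num_vars :: "fm \<Rightarrow> nat set" where
  "free_num_vars (Eq t u) = tm_vars t \<union> tm_vars u"
| "free_num_vars (Less t u) = tm_vars t \<union> tm_vars u"
| "free_num_vars (Mem t A) = tm_vars t"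
| "free_num_vars (Neg f) = free_num_vars f"
| "free_num_vars (Conj f g) = free_num_vars f \<union> free_num_vars g"
| "free_num_vars (Disj f g) = free_num_vars f \<union> free_num_vars g"
| "free_num_vars (Imp f g) = free_num_vars f \<union> free_num_vars g"
| "free_num_vars (Iff f g) = free_num_vars f \<union> free_num_vars g"
| "free_num_vars (AllN n f) = free_num_vars f - {n}"
| "free_num_vars (ExN n f) = free_num_vars f - {n}"
| "free_num_vars (AllS A f) = free_num_vars f"
| "free_num_vars (ExS A f) = free_num_vars f"

primrec free_set_vars :: "fm \<Rightarrow> nat set" where
  "free_set_vars (Eq t u) = {}"
| "free_set_vars (Less t u) = {}"
| "free_set_vars (Mem t A) = {A}"
| "free_set_vars (Neg f) = free_set_vars f"
| "free_set_vars (Conj f g) = free_set_vars f \<union> free_set_vars g"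
| "free_set_vars (Disj f g) = free_set_vars f \<union> free_set_vars g"
| "free_set_vars (Imp f g) = free_set_vars f \<union> free_set_vars g"
| "free_set_vars (Iff f g) = free_set_vars f \<union> free_set_vars g"
| "free_set_vars (AllN n f) = free_set_vars f"
| "free_set_vars (ExN n f) = free_set_vars f"
| "free_set_vars (AllS A f) = free_set_vars f - {A}"
| "free_set_vars (ExS A f) = free_set_vars f - {A}"

primrec arithmetical :: "fm \<Rightarrow> bool" where
  "arithmetical (Eq t u) \<longleftrightarrow> True"
| "arithmetical (Less t u) \<longleftrightarrow> True"
| "arithmetical (Mem t A) \<longleftrightarrow> True"
| "arithmetical (Neg f) \<longleftrightarrow> arithmetical f"
| "arithmetical (Conj f g) \<longleftrightarrow> arithmetical f \<and> arithmetical g"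
| "arithmetical (Disj f g) \<longleftrightarrow> arithmetical f \<and> arithmetical g"
| "arithmetical (Imp f g) \<longleftrightarrow> arithmetical f \<and> arithmetical g"
| "arithmetical (Iff f g) \<longleftrightarrow> arithmetical f \<and> arithmetical g"
| "arithmetical (AllN n f) \<longleftrightarrow> arithmetical f"
| "arithmetical (ExN n f) \<longleftrightarrow> arithmetical f"
| "arithmetical (AllS A f) \<longleftrightarrow> False"
| "arithmetical (ExS A f) \<longleftrightarrow> False"

definition Pi11 :: "fm \<Rightarrow> bool" where
  "Pi11 f \<longleftrightarrow> (\<exists>A g. f = AllS A g \<and> arithmetical g)"

section \<open>Coded countable posets\<close>

text \<open>The carrier of a countable poset is a set of natural numbers, and its order is coded as
  the set of codes of its pairs. A formula with free set variables 0 (carrier), 1 (order) and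
  2 (the argument \<open>X\<close>) defines a predicate on posets and subsets when it does so uniformly in
  all coded posets, without further parameters.\<close>

definition order_code :: "nat rel \<Rightarrow> nat set" where
  "order_code r = prod_encode ` r"

definition defines_poset_predicate ::
    "fm \<Rightarrow> (nat set \<Rightarrow> nat rel \<Rightarrow> nat set \<Rightarrow> bool) \<Rightarrow> bool" where
  "defines_poset_predicate f Q \<longleftrightarrow>
     free_num_vars f = {} \<and> free_set_vars f \<subseteq> {0, 1, 2} \<and>
     (\<forall>P r X e s. partial_order_on P r \<longrightarrow>
        (sat e (s(0 := P, 1 := order_code r, 2 := X)) f \<longleftrightarrow> Q P r X))"

end

theory Submission
  imports Defs
begin

text \<open>Being a filter is arithmetical in the set, the carrier and the coded order, and maximality
  only adds a quantifier over the possible proper extensions \<open>Y\<close>, which becomes universal under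
  the negation and can be moved to the front. The remaining point is that the pairing function
  used to code the order has an arithmetical graph.\<close>

text \<open>The equation in the second conjunct of \<open>le_fm\<close> is the definition of the Cantor pairing
  function, multiplied by 2 to avoid the division in the triangular number. The bound variable
  is chosen distinct from \<open>x\<close> and \<open>y\<close>.\<close>

definition le_fm :: "nat \<Rightarrow> nat \<Rightarrow> fm" where
  "le_fm x y =
     (let p = Var (Suc (x + y)); n = Add (Var x) (Var y) in
      ExN (Suc (x + y)) (Conj (Mem p 1)
        (Eq (Add p p) (Add (Mult n (Add n One)) (Add (Var x) (Var x))))))"

definition subset_fm :: "nat \<Rightarrow> nat \<Rightarrow> fm" where
  "subset_fm A B = AllN 0 (Imp (Mem (Var 0) A) (Mem (Var 0) B))"

definition filter_fm :: "nat \<Rightarrow> fm" where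
  "filter_fm A =
     Conj (Conj (subset_fm A 0) (Conj (ExN 0 (Mem (Var 0) A))
       (AllN 0 (Imp (Mem (Var 0) A) (AllN 1 (Imp (Mem (Var 1) A)
         (ExN 2 (Conj (Mem (Var 2) A) (Conj (le_fm 2 0) (le_fm 2 1)))))))))
     ) (AllN 0 (Imp (Mem (Var 0) A) (AllN 1 (Imp (Mem (Var 1) 0)
         (Imp (le_fm 0 1) (Mem (Var 1) A))))))"

definition max_filt_fm :: fm where
  "max_filt_fm = AllS 3 (Conj (filter_fm 2)
     (Neg (Conj (filter_fm 3) (Conj (subset_fm 2 3) (Neg (subset_fm 3 2))))))"

lemma eq_prod_encode_iff:
  "p = prod_encode (x, y) \<longleftrightarrow> p + p = (x + y) * (x + y + 1) + (x + x)"
proof -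
  have "triangle n + triangle n = n * (n + 1)" for n
    by (induction n) auto
  from this[of "x + y"] show ?thesis
    unfolding prod_encode_def prod.case by linarith
qed

lemma prod_encode_in_order_code [simp]: "prod_encode (x, y) \<in> order_code r \<longleftrightarrow> (x, y) \<in> r"
  unfolding order_code_def using inj_prod_encode[of UNIV] by (simp add: inj_image_mem_iff)

lemma sat_le_fm [simp]:
  assumes "s 1 = order_code r"
  shows "sat e s (le_fm x y) \<longleftrightarrow> (e x, e y) \<in> r"
proof -
  have "sat e s (le_fm x y) \<longleftrightarrow> (\<exists>p. p \<in> s 1 \<and> p = prod_encode (e x, e y))"
    unfolding eq_prod_encode_iff by (simp add: le_fm_def Let_def)
  then show ?thesis
    using assms by simp
qed

lemma sat_subset_fm [simp]: "sat e s (subset_fm A B) \<longleftrightarrow> s A \<subseteq> s B"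
  by (auto simp: subset_fm_def)

lemma sat_filter_fm [simp]:
  assumes "s 1 = order_code r"
  shows "sat e s (filter_fm A) \<longleftrightarrow> filter_on (s 0) r (s A)"
  using assms by (simp add: filter_fm_def filter_on_def prefilter_on_def Ball_def Bex_def ex_in_conv)

lemma sat_max_filt_fm [simp]:
  assumes "s 1 = order_code r"
  shows "sat e s max_filt_fm \<longleftrightarrow> MaxFilt (s 0) r (s 2)"
  using assms by (simp add: max_filt_fm_def MaxFilt_def less_le_not_le)

lemma Pi11_max_filt_fm: "Pi11 max_filt_fm"
  by (simp add: Pi11_def max_filt_fm_def filter_fm_def subset_fm_def le_fm_def Let_def)

lemma free_num_vars_max_filt_fm: "free_num_vars max_filt_fm = {}"
  by (auto simp: max_filt_fm_def filter_fm_def subset_fm_def le_fm_def Let_def)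

lemma free_set_vars_max_filt_fm: "free_set_vars max_filt_fm \<subseteq> {0, 1, 2}"
  by (auto simp: max_filt_fm_def filter_fm_def subset_fm_def le_fm_def Let_def)

theorem lemma13: "\<exists>f. Pi11 f \<and> defines_poset_predicate f MaxFilt"
  using Pi11_max_filt_fm free_num_vars_max_filt_fm free_set_vars_max_filt_fm
  by (intro exI[of _ max_filt_fm]) (simp add: defines_poset_predicate_def)

end
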